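(* For every odd positive integer $n$, $$\sigma_{3}(n)=12\sum_{\substack{i,j\ge 0\\ i+j=n}}\widehat{\sigma}(i)\,\widehat{\sigma}(j),\qquad \sigma_{5}(n)=192\sum_{\substack{i,j,k\ge 0\\ i+j+k=n}}\widehat{\sigma}(i)\,\widehat{\sigma}(j)\,\widehat{\sigma}(k),$$ where $\widehat{\sigma}(0)=\tfrac1{24}$.
   Context: For integers $n\ge1$, $\sigma_{s}(n)=\sum_{d\mid n}d^{s}$ and $\widehat{\sigma}(n)=\widehat{\sigma}_{1}(n)=\sum_{d\mid n}(-1)^{n/d-1}d$. The value $\widehat{\sigma}(0)$ is assigned as in the claim. *)

theory Defs
  imports Complex_Main
begin

definition divisor_sigma :: "nat \<Rightarrow> nat \<Rightarrow> nat" where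
  "divisor_sigma s n = (\<Sum>d | d dvd n. d ^ s)"

(* For n > 0 and d dvd n we have n div d \<ge> 1, so the subtraction in the exponent
   does not truncate. The value 1/24 at 0 is a convention: the divisor sum is only
   meant for positive arguments. *)
definition hat_sigma :: "nat \<Rightarrow> real" where
  "hat_sigma n =
    (if n = 0 then 1 / 24 else (\<Sum>d | d dvd n. (-1) ^ (n div d - 1) * real d))"

end

theory Submission
  imports Defs
begin

text \<open>
  Write \<open>hat_sigma n\<close> as a sum over factorizations \<open>n = a x\<close> of \<open>- (-1)^x a\<close>. A convolution
  then becomes a sum over \<open>a x + b y = n\<close>, and polynomial weights such as \<open>4 a b\<close> or
  \<open>8 (a^3 b + a b^3)\<close> have the form \<open>f (a + b) - f (a - b)\<close> with \<open>f\<close> even. Liouville's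
  method evaluates such sums: \<open>a x + b y = a (x - y) + (a + b) y\<close> gives bijections under which
  everything cancels except the diagonals \<open>x = y\<close> and \<open>a = b\<close>. Taking \<open>f t = t^2\<close> with sign
  \<open>(-1)^(x + y)\<close> evaluates the double convolution for every \<open>n > 0\<close>. The triple convolution
  reduces to two sums with \<open>f t = t^4\<close>, one carrying the same sign and the other restricted to
  odd \<open>a\<close> and \<open>b\<close>.
\<close>

section \<open>Solutions of \<open>a * x + b * y = n\<close> and their symmetries\<close>

definition quad :: "nat \<Rightarrow> (nat \<times> nat \<times> nat \<times> nat) set" where
  "quad n = {(a, x, b, y). 0 < a \<and> 0 < x \<and> 0 < b \<and> 0 < y \<and> a * x + b * y = n}"

lemma finite_quad [simp]: "finite (quad n)"
proof (rule finite_subset)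
  show "quad n \<subseteq> {..n} \<times> {..n} \<times> {..n} \<times> {..n}"
  proof
    fix q assume "q \<in> quad n"
    then obtain a x b y where q: "q = (a, x, b, y)" "0 < a" "0 < x" "0 < b" "0 < y"
        "a * x + b * y = n"
      by (auto simp: quad_def)
    have "a \<le> a * x" "x \<le> a * x" "b \<le> b * y" "y \<le> b * y"
      using q by auto
    then show "q \<in> {..n} \<times> {..n} \<times> {..n} \<times> {..n}"
      using q by (auto simp del: One_nat_def intro: trans_le_add1 trans_le_add2)
  qed
qed auto

text \<open>The compared quantities \<open>p\<close> and \<open>r\<close> are left open so that one
  split serves both \<open>x\<close> against \<open>y\<close> and \<open>a\<close> against
  \<open>b\<close>.\<close>

lemma sum_quad_trichotomy:
  fixes g :: "nat \<Rightarrow> nat \<Rightarrow> nat \<Rightarrow> nat \<Rightarrow> real" and p r :: "nat \<Rightarrow> nat \<Rightarrow> nat \<Rightarrow> nat \<Rightarrow> nat"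
  shows "(\<Sum>(a, x, b, y)\<in>quad n. g a x b y) =
    (\<Sum>(a, x, b, y)\<in>{(a, x, b, y) \<in> quad n. p a x b y < r a x b y}. g a x b y) +
    (\<Sum>(a, x, b, y)\<in>{(a, x, b, y) \<in> quad n. r a x b y < p a x b y}. g a x b y) +
    (\<Sum>(a, x, b, y)\<in>{(a, x, b, y) \<in> quad n. p a x b y = r a x b y}. g a x b y)"
    (is "_ = sum _ ?L + sum _ ?G + sum _ ?E")
proof -
  have fin: "finite ?L" "finite ?G" "finite ?E"
    by (auto intro: finite_subset[OF _ finite_quad])
  have "quad n = (?L \<union> ?G) \<union> ?E"
    by auto
  then have "(\<Sum>(a, x, b, y)\<in>quad n. g a x b y) =
      (\<Sum>(a, x, b, y)\<in>(?L \<union> ?G) \<union> ?E. g a x b y)"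
    by simp
  also have "\<dots> = (\<Sum>(a, x, b, y)\<in>?L. g a x b y) + (\<Sum>(a, x, b, y)\<in>?G. g a x b y) +
      (\<Sum>(a, x, b, y)\<in>?E. g a x b y)"
    using fin by (subst sum.union_disjoint; (subst sum.union_disjoint)?; auto)
  finally show ?thesis .
qed

lemma sum_quad_swap:
  fixes g :: "nat \<Rightarrow> nat \<Rightarrow> nat \<Rightarrow> nat \<Rightarrow> real"
  shows "(\<Sum>(a, x, b, y)\<in>{(a, x, b, y) \<in> quad n. P a x b y}. g a x b y) =
    (\<Sum>(a, x, b, y)\<in>{(a, x, b, y) \<in> quad n. P b y a x}. g b y a x)"
  by (rule sum.reindex_bij_witness[where i = "\<lambda>(a, x, b, y). (b, y, a, x)"
        and j = "\<lambda>(a, x, b, y). (b, y, a, x)"])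
    (auto simp: quad_def)

text \<open>Since \<open>a x + b y = a (x - y) + (a + b) y\<close>, the map
  \<open>(a, x, b, y)\<close> to \<open>(a, x - y, a + b, y)\<close> stays in \<open>quad n\<close>.
  The conditions \<open>y < x\<close> and \<open>a < b\<close> are what keeps the new coordinates
  positive in the two directions.\<close>

lemma sum_quad_shear:
  fixes g :: "nat \<Rightarrow> nat \<Rightarrow> nat \<Rightarrow> nat \<Rightarrow> real"
  shows "(\<Sum>(a, x, b, y)\<in>{(a, x, b, y) \<in> quad n. y < x}. g a x b y) =
    (\<Sum>(a, x, b, y)\<in>{(a, x, b, y) \<in> quad n. a < b}. g a (x + y) (b - a) y)"
proof (rule sum.reindex_bij_witness[where i = "\<lambda>(a, x, b, y). (a, x + y, b - a, y)"
        and j = "\<lambda>(a, x, b, y). (a, x - y, a + b, y)"], goal_cases)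
  case (2 q)
  then obtain a x b y where q: "q = (a, x, b, y)" "y < x" and n: "(a, x, b, y) \<in> quad n"
    by auto
  then obtain c where "x = y + c" "0 < c"
    using less_imp_add_positive by blast
  then show ?case
    using q n by (auto simp: quad_def algebra_simps)
next
  case (4 q)
  then obtain a x b y where q: "q = (a, x, b, y)" "a < b" and n: "(a, x, b, y) \<in> quad n"
    by auto
  then obtain c where "b = a + c" "0 < c"
    using less_imp_add_positive by blast
  then show ?case
    using q n by (auto simp: quad_def algebra_simps)
qed auto

section \<open>The diagonals \<open>x = y\<close> and \<open>a = b\<close> as divisor sums\<close>

text \<open>For \<open>x = y\<close> the equation reads \<open>(a + b) x = n\<close>, so
  \<open>d = a + b\<close> is a divisor with cofactor \<open>x\<close>, and \<open>b\<close> is free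
  below \<open>d\<close>.\<close>

lemma sum_quad_diagonal_x:
  fixes g :: "nat \<Rightarrow> nat \<Rightarrow> nat \<Rightarrow> real"
  assumes "0 < n"
  shows "(\<Sum>(a, x, b, y)\<in>{(a, x, b, y) \<in> quad n. x = y}. g a x b) =
    (\<Sum>d | d dvd n. \<Sum>b\<in>{1..<d}. g (d - b) (n div d) b)"
proof -
  have fin: "finite {d. d dvd n}"
    using assms by simp
  have "(\<Sum>d | d dvd n. \<Sum>b\<in>{1..<d}. g (d - b) (n div d) b) =
      (\<Sum>(d, b)\<in>(SIGMA d:{d. d dvd n}. {1..<d}). g (d - b) (n div d) b)"
    using fin by (simp add: sum.Sigma)
  also have "\<dots> = (\<Sum>(a, x, b, y)\<in>{(a, x, b, y) \<in> quad n. x = y}. g a x b)"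
  proof (rule sum.reindex_bij_witness[where i = "\<lambda>(a, x, b, y). (a + b, b)"
        and j = "\<lambda>(d, b). (d - b, n div d, b, n div d)"], goal_cases)
    case (2 p)
    then obtain d b k where p: "p = (d, b)" "1 \<le> b" "b < d" "n = d * k" and k: "n div d = k"
      using assms by (auto elim: dvdE)
    then have "(d - b) * k + b * k = n"
      by (simp flip: add_mult_distrib)
    then show ?case
      using p k assms by (auto simp: quad_def)
  next
    case (3 q)
    then obtain a x b where q: "q = (a, x, b, x)" "0 < a" "n = (a + b) * x"
      by (auto simp: quad_def add_mult_distrib)
    then have "n div (a + b) = x"
      by simp
    then show ?case
      using q by simp
  next
    case (4 q)
    then obtain a x b where q: "q = (a, x, b, x)" "0 < a" "0 < b" "n = (a + b) * x"
      by (auto simp: quad_def add_mult_distrib)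
    then have "a + b dvd n"
      by (simp only: dvd_triv_left)
    then show ?case
      using q by auto
  qed auto
  finally show ?thesis by simp
qed

text \<open>For \<open>a = b\<close> the equation reads \<open>b (x + y) = n\<close>, so
  \<open>d = b\<close> is a divisor and \<open>x\<close> is free below its cofactor.\<close>

lemma sum_quad_diagonal_a:
  fixes g :: "nat \<Rightarrow> nat \<Rightarrow> real"
  assumes "0 < n"
  shows "(\<Sum>(a, x, b, y)\<in>{(a, x, b, y) \<in> quad n. a = b}. g x b) =
    (\<Sum>d | d dvd n. \<Sum>x\<in>{1..<n div d}. g x d)"
proof -
  have fin: "finite {d. d dvd n}"
    using assms by simp
  have "(\<Sum>d | d dvd n. \<Sum>x\<in>{1..<n div d}. g x d) =
      (\<Sum>(d, x)\<in>(SIGMA d:{d. d dvd n}. {1..<n div d}). g x d)"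
    using fin by (simp add: sum.Sigma)
  also have "\<dots> = (\<Sum>(a, x, b, y)\<in>{(a, x, b, y) \<in> quad n. a = b}. g x b)"
  proof (rule sum.reindex_bij_witness[where i = "\<lambda>(a, x, b, y). (b, x)"
        and j = "\<lambda>(d, x). (d, x, d, n div d - x)"], goal_cases)
    case (2 p)
    then obtain d x k where "p = (d, x)" "n = d * k" "1 \<le> x" "x < k" "0 < d"
      using assms by (auto elim: dvdE)
    moreover from this obtain c where "k = x + c" "0 < c"
      using less_imp_add_positive by blast
    ultimately show ?case
      by (auto simp: quad_def add_mult_distrib2)
  next
    case (3 q)
    then obtain x b y where q: "q = (b, x, b, y)" "0 < b" "n = b * (x + y)"
      by (auto simp: quad_def add_mult_distrib2)
    then have "n div b = x + y"
      by simp
    then show ?case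
      using q by simp
  next
    case (4 q)
    then obtain x b y where q: "q = (b, x, b, y)" "0 < b" "0 < x" "0 < y" "n = b * (x + y)"
      by (auto simp: quad_def add_mult_distrib2)
    then have "n div b = x + y" "b dvd n"
      by simp_all
    then show ?case
      using q by auto
  qed auto
  finally show ?thesis by simp
qed

section \<open>Liouville's identity\<close>

text \<open>The shear fixes \<open>a\<close> and \<open>y\<close>; conjugated by the swap it fixes
  \<open>b\<close> and \<open>x\<close>, the only coordinates on which the summand depends.\<close>

lemma sum_quad_shear_a:
  fixes g :: "nat \<Rightarrow> nat \<Rightarrow> real"
  shows "(\<Sum>(a, x, b, y)\<in>{(a, x, b, y) \<in> quad n. b < a}. g x b) =
    (\<Sum>(a, x, b, y)\<in>{(a, x, b, y) \<in> quad n. x < y}. g x b)"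
proof -
  have "(\<Sum>(a, x, b, y)\<in>{(a, x, b, y) \<in> quad n. b < a}. g x b) =
      (\<Sum>(a, x, b, y)\<in>{(a, x, b, y) \<in> quad n. a < b}. g y a)"
    by (rule sum_quad_swap)
  also have "\<dots> = (\<Sum>(a, x, b, y)\<in>{(a, x, b, y) \<in> quad n. y < x}. g y a)"
    by (rule sum_quad_shear[symmetric, where g = "\<lambda>a x b y. g y a"])
  also have "\<dots> = (\<Sum>(a, x, b, y)\<in>{(a, x, b, y) \<in> quad n. x < y}. g x b)"
    by (rule sum_quad_swap)
  finally show ?thesis .
qed

text \<open>The part with \<open>f (a + b)\<close> is split by \<open>x\<close> against
  \<open>y\<close> and the part with \<open>f (a - b)\<close> by \<open>a\<close> against
  \<open>b\<close>. Shearing gives \<open>2 * B + D\<close> and \<open>2 * X\<close>. The unknown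
  difference \<open>B - X\<close> comes from splitting the single sum of
  \<open>\<phi> x * f b\<close> in both ways, so only diagonals remain.\<close>

lemma liouville:
  fixes f :: "int \<Rightarrow> real" and \<phi> :: "nat \<Rightarrow> real"
  assumes n: "0 < n" and f_even: "\<And>t. f (- t) = f t" and f_0: "f 0 = 0"
    and periodic: "\<And>x y. \<phi> (x + 2 * y) = \<phi> x"
  shows "(\<Sum>(a, x, b, y)\<in>quad n. \<phi> (x + y) * (f (int a + int b) - f (int a - int b))) =
    (\<Sum>d | d dvd n. \<phi> 0 * (real d - 1) * f (int d) + 2 * \<phi> (n div d) * (\<Sum>b\<in>{1..<d}. f (int b))
       - 2 * f (int d) * (\<Sum>x\<in>{1..<n div d}. \<phi> x))"
proof -
  have periodic': "\<phi> (x + y + y) = \<phi> x" for x y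
    using periodic[of x y] by (simp add: mult_2 add.assoc)
  define B where "B = (\<Sum>(a, x, b, y)\<in>{(a, x, b, y) \<in> quad n. a < b}. \<phi> x * f (int b))"
  define X where "X = (\<Sum>(a, x, b, y)\<in>{(a, x, b, y) \<in> quad n. y < x}. \<phi> x * f (int b))"
  define DX where "DX = (\<Sum>(a, x, b, y)\<in>{(a, x, b, y) \<in> quad n. x = y}. \<phi> x * f (int b))"
  define DA where "DA = (\<Sum>(a, x, b, y)\<in>{(a, x, b, y) \<in> quad n. a = b}. \<phi> x * f (int b))"
  define D where "D = (\<Sum>(a, x, b, y)\<in>{(a, x, b, y) \<in> quad n. x = y}. \<phi> (x + y) * f (int a + int b))"

  \<comment> \<open>Substituting \<open>x + y\<close> for \<open>x\<close> and \<open>b - a\<close>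
    for \<open>b\<close> turns \<open>\<phi> (x + y)\<close> into \<open>\<phi> (x + 2 * y)\<close>,
    which is \<open>\<phi> x\<close>, and \<open>f (a + b)\<close> into \<open>f b\<close>.\<close>
  have gt: "(\<Sum>(a, x, b, y)\<in>{(a, x, b, y) \<in> quad n. y < x}. \<phi> (x + y) * f (int a + int b)) = B"
    unfolding B_def
    by (subst sum_quad_shear[where g = "\<lambda>a x b y. \<phi> (x + y) * f (int a + int b)"],
        rule sum.cong) (auto simp: periodic' of_nat_diff)
  have lt: "(\<Sum>(a, x, b, y)\<in>{(a, x, b, y) \<in> quad n. x < y}. \<phi> (x + y) * f (int a + int b)) = B"
    by (subst sum_quad_swap[where g = "\<lambda>a x b y. \<phi> (x + y) * f (int a + int b)"])
      (simp add: gt[symmetric] add.commute)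
  have plus: "(\<Sum>(a, x, b, y)\<in>quad n. \<phi> (x + y) * f (int a + int b)) = 2 * B + D"
    using gt lt
    by (subst sum_quad_trichotomy[where p = "\<lambda>a x b y. x" and r = "\<lambda>a x b y. y"]) (simp add: D_def)

  have f_diff: "f (int a - int b) = f (int b - int a)" for a b
    using f_even[of "int a - int b"] by simp
  \<comment> \<open>The same substitution applied to the summand of \<open>X\<close> produces
    \<open>\<phi> (x + y) * f (b - a)\<close>; evenness of \<open>f\<close> does the rest.\<close>
  have lt': "(\<Sum>(a, x, b, y)\<in>{(a, x, b, y) \<in> quad n. a < b}. \<phi> (x + y) * f (int a - int b)) = X"
    unfolding X_def
    by (subst sum_quad_shear[where g = "\<lambda>a x b y. \<phi> x * f (int b)"], rule sum.cong)
      (auto simp: of_nat_diff intro: f_diff)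
  have gt': "(\<Sum>(a, x, b, y)\<in>{(a, x, b, y) \<in> quad n. b < a}. \<phi> (x + y) * f (int a - int b)) = X"
    by (subst sum_quad_swap[where g = "\<lambda>a x b y. \<phi> (x + y) * f (int a - int b)"])
      (unfold lt'[symmetric], rule sum.cong, auto simp: add.commute intro: f_diff)
  have eq': "(\<Sum>(a, x, b, y)\<in>{(a, x, b, y) \<in> quad n. a = b}. \<phi> (x + y) * f (int a - int b)) = 0"
    by (rule sum.neutral) (auto simp: f_0)
  have minus: "(\<Sum>(a, x, b, y)\<in>quad n. \<phi> (x + y) * f (int a - int b)) = 2 * X"
    using gt' lt' eq'
    by (subst sum_quad_trichotomy[where p = "\<lambda>a x b y. a" and r = "\<lambda>a x b y. b"]) simp

  \<comment> \<open>The two splittings leave the regions \<open>b < a\<close> and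
    \<open>x < y\<close>, whose contributions agree by \<open>sum_quad_shear_a\<close>.\<close>
  have "(\<Sum>(a, x, b, y)\<in>quad n. \<phi> x * f (int b)) =
      B + (\<Sum>(a, x, b, y)\<in>{(a, x, b, y) \<in> quad n. b < a}. \<phi> x * f (int b)) + DA"
    unfolding B_def DA_def by (rule sum_quad_trichotomy)
  moreover have "(\<Sum>(a, x, b, y)\<in>quad n. \<phi> x * f (int b)) =
      (\<Sum>(a, x, b, y)\<in>{(a, x, b, y) \<in> quad n. x < y}. \<phi> x * f (int b)) + X + DX"
    unfolding X_def DX_def by (rule sum_quad_trichotomy)
  ultimately have BX: "B + DA = X + DX"
    using sum_quad_shear_a[where g = "\<lambda>x b. \<phi> x * f (int b)"] by simp

  have DX: "DX = (\<Sum>d | d dvd n. \<phi> (n div d) * (\<Sum>b\<in>{1..<d}. f (int b)))"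
    unfolding DX_def using n
    by (subst sum_quad_diagonal_x[where g = "\<lambda>a x b. \<phi> x * f (int b)"]) (simp_all add: sum_distrib_left)
  have DA: "DA = (\<Sum>d | d dvd n. f (int d) * (\<Sum>x\<in>{1..<n div d}. \<phi> x))"
    unfolding DA_def using n
    by (subst sum_quad_diagonal_a[where g = "\<lambda>x b. \<phi> x * f (int b)"])
      (simp_all add: sum_distrib_left mult.commute)
  \<comment> \<open>On this diagonal \<open>x + y = 2 * x\<close>, which periodicity reduces to
    \<open>0\<close>.\<close>
  have "D = (\<Sum>(a, x, b, y)\<in>{(a, x, b, y) \<in> quad n. x = y}. \<phi> 0 * f (int a + int b))"
    unfolding D_def by (rule sum.cong) (use periodic'[of 0] in auto)
  also have "\<dots> = (\<Sum>d | d dvd n. \<Sum>b\<in>{1..<d}. \<phi> 0 * f (int (d - b) + int b))"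
    using n by (rule sum_quad_diagonal_x)
  also have "\<dots> = (\<Sum>d | d dvd n. \<phi> 0 * (real d - 1) * f (int d))"
  proof (rule sum.cong)
    fix d assume "d \<in> {d. d dvd n}"
    then have "d > 0"
      using n by (auto intro: dvd_pos_nat)
    have "(\<Sum>b\<in>{1..<d}. \<phi> 0 * f (int (d - b) + int b)) = (\<Sum>b\<in>{1..<d}. \<phi> 0 * f (int d))"
      by (rule sum.cong) auto
    also have "\<dots> = \<phi> 0 * (real d - 1) * f (int d)"
      using \<open>d > 0\<close> by (simp add: of_nat_diff)
    finally show "(\<Sum>b\<in>{1..<d}. \<phi> 0 * f (int (d - b) + int b)) = \<phi> 0 * (real d - 1) * f (int d)" .
  qed simp
  finally have D: "D = (\<Sum>d | d dvd n. \<phi> 0 * (real d - 1) * f (int d))" .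

  have "(\<Sum>(a, x, b, y)\<in>quad n. \<phi> (x + y) * (f (int a + int b) - f (int a - int b))) =
      2 * B + D - 2 * X"
    unfolding plus[symmetric] minus[symmetric] sum_subtractf[symmetric]
    by (rule sum.cong) (auto simp: algebra_simps)
  also have "\<dots> = D + 2 * DX - 2 * DA"
    using BX by simp
  also have "\<dots> = (\<Sum>d | d dvd n. \<phi> 0 * (real d - 1) * f (int d) +
      2 * \<phi> (n div d) * (\<Sum>b\<in>{1..<d}. f (int b)) - 2 * f (int d) * (\<Sum>x\<in>{1..<n div d}. \<phi> x))"
    unfolding D DX DA by (simp add: sum.distrib sum_subtractf sum_distrib_left mult.assoc)
  finally show ?thesis .
qed

section \<open>Convolutions of divisor sums\<close>

text \<open>Solutions are grouped by \<open>i = a * x\<close> and \<open>j = b * y\<close>; then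
  \<open>a\<close> and \<open>b\<close> are divisors, and \<open>x\<close> and \<open>y\<close>
  their cofactors.\<close>

lemma sum_quad_conv:
  fixes u v :: "nat \<Rightarrow> nat \<Rightarrow> real"
  shows "(\<Sum>(a, x, b, y)\<in>quad n. u a x * v b y) =
    (\<Sum>(i, j)\<in>{(i, j). 0 < i \<and> 0 < j \<and> i + j = n}.
      (\<Sum>d | d dvd i. u d (i div d)) * (\<Sum>d | d dvd j. v d (j div d)))"
    (is "_ = sum _ ?P")
proof -
  have fin: "finite ?P"
    by (rule finite_subset[of _ "{..n} \<times> {..n}"]) auto
  have "(\<Sum>(i, j)\<in>?P. (\<Sum>d | d dvd i. u d (i div d)) * (\<Sum>d | d dvd j. v d (j div d))) =
      (\<Sum>p\<in>?P. \<Sum>(a, b)\<in>{a. a dvd fst p} \<times> {b. b dvd snd p}. u a (fst p div a) * v b (snd p div b))"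
    by (simp add: case_prod_beta sum_product sum.cartesian_product)
  also have "\<dots> = (\<Sum>(p, a, b)\<in>(SIGMA p:?P. {a. a dvd fst p} \<times> {b. b dvd snd p}).
      u a (fst p div a) * v b (snd p div b))"
    using fin by (subst sum.Sigma) (auto simp: case_prod_beta)
  also have "\<dots> = (\<Sum>(a, x, b, y)\<in>quad n. u a x * v b y)"
    by (rule sum.reindex_bij_witness[where i = "\<lambda>(a, x, b, y). ((a * x, b * y), a, b)"
          and j = "\<lambda>((i, j), a, b). (a, i div a, b, j div b)"])
      (auto simp: quad_def)
  finally show ?thesis by simp
qed

section \<open>Parity of divisors and two forms of \<open>hat_sigma\<close>\<close>

text \<open>Halving: \<open>2 * d\<close> divides \<open>n\<close> exactly when \<open>d\<close>
  does with an even cofactor.\<close>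

lemma sum_even_divisors:
  fixes g :: "nat \<Rightarrow> real"
  assumes "0 < n"
  shows "(\<Sum>d | d dvd n. if even d then g d else 0) =
    (\<Sum>d | d dvd n. if even (n div d) then g (2 * d) else 0)"
proof -
  have fin: "finite {d. d dvd n}"
    using assms by simp
  have "(\<Sum>d | d dvd n. if even d then g d else 0) = (\<Sum>d | d dvd n \<and> even d. g d)"
    using fin by (simp add: sum.inter_filter[symmetric])
  also have "\<dots> = (\<Sum>d | d dvd n \<and> even (n div d). g (2 * d))"
    by (rule sum.reindex_bij_witness[where i = "\<lambda>d. 2 * d" and j = "\<lambda>d. d div 2"])
      (use assms in \<open>auto elim!: dvdE\<close>)
  also have "\<dots> = (\<Sum>d | d dvd n. if even (n div d) then g (2 * d) else 0)"
    using fin by (simp add: sum.inter_filter[symmetric])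
  finally show ?thesis .
qed

text \<open>The even divisors are subtracted from all divisors; written as \<open>2 * d\<close>,
  each contributes \<open>2 ^ s\<close> times \<open>d ^ s\<close>.\<close>

lemma sum_odd_divisors_power:
  assumes "0 < n"
  shows "(\<Sum>d | d dvd n. if odd d then real d ^ s else 0) =
    (\<Sum>d | d dvd n. real d ^ s * (if even (n div d) then 1 - 2 ^ s else 1))"
proof -
  have "(\<Sum>d | d dvd n. if odd d then real d ^ s else 0) =
      (\<Sum>d | d dvd n. real d ^ s) - (\<Sum>d | d dvd n. if even d then real d ^ s else 0)"
    unfolding sum_subtractf[symmetric] by (rule sum.cong) auto
  also have "\<dots> = (\<Sum>d | d dvd n. real d ^ s * (if even (n div d) then 1 - 2 ^ s else 1))"
    unfolding sum_even_divisors[OF assms] sum_subtractf[symmetric]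
    by (rule sum.cong) (auto simp: power_mult_distrib algebra_simps)
  finally show ?thesis .
qed

text \<open>Moves the sign to the exponent \<open>n div d\<close>, so that the signs of two factors
  combine to \<open>(-1) ^ (x + y)\<close>.\<close>

lemma hat_sigma_signed:
  assumes "0 < n"
  shows "hat_sigma n = (\<Sum>d | d dvd n. - ((-1) ^ (n div d) * real d))"
  unfolding hat_sigma_def using assms
proof (simp, intro sum.cong refl)
  fix d assume "d \<in> {d. d dvd n}"
  then have "0 < n div d"
    using assms by (auto elim: dvdE)
  then obtain k where "n div d = Suc k"
    by (auto simp: gr0_conv_Suc)
  then show "(-1) ^ (n div d - Suc 0) * real d = - ((-1) ^ (n div d) * real d)"
    by simp
qed

text \<open>At \<open>s = 1\<close> the coefficient \<open>1 - 2 ^ s\<close> is \<open>-1\<close>,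
  which is the sign at an even cofactor.\<close>

lemma hat_sigma_odd_divisors:
  assumes "0 < n"
  shows "hat_sigma n = (\<Sum>d | d dvd n. if odd d then real d else 0)"
proof -
  have "hat_sigma n = (\<Sum>d | d dvd n. real d ^ 1 * (if even (n div d) then 1 - 2 ^ 1 else 1))"
    unfolding hat_sigma_signed[OF assms] by (rule sum.cong) auto
  then show ?thesis
    unfolding sum_odd_divisors_power[OF assms, symmetric] by (simp only: power_one_right)
qed

section \<open>Finite power sums\<close>

lemma sum_square_lessThan: "(\<Sum>b\<in>{1..<d}. real b ^ 2) = (2 * real d ^ 3 - 3 * real d ^ 2 + real d) / 6"
  by (induction d) (auto simp: field_simps power2_eq_square power3_eq_cube not_less_eq_eq)

lemma sum_power4_lessThan:
  "(\<Sum>b\<in>{1..<d}. real b ^ 4) = (6 * real d ^ 5 - 15 * real d ^ 4 + 10 * real d ^ 3 - real d) / 30"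
  by (induction d) (auto simp: field_simps eval_nat_numeral not_less_eq_eq)

text \<open>Induction on \<open>m\<close> with \<open>d = 2 * m + 1\<close>: each step adds two
  terms, of which only \<open>2 * m + 2\<close> is even.\<close>

lemma sum_even_power4_lessThan:
  assumes "odd d"
  shows "(\<Sum>b\<in>{1..<d}. if even b then real b ^ 4 else 0) =
    (3 * real d ^ 5 - 10 * real d ^ 3 + 7 * real d) / 30"
proof -
  have "(\<Sum>b\<in>{1..<2 * m + 1}. if even b then real b ^ 4 else 0) =
      (3 * real (2 * m + 1) ^ 5 - 10 * real (2 * m + 1) ^ 3 + 7 * real (2 * m + 1)) / 30" for m
  proof (induction m)
    case (Suc m)
    have "{1..<2 * Suc m + 1} = insert (2 * m + 2) (insert (2 * m + 1) {1..<2 * m + 1})"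
      by auto
    then have "(\<Sum>b\<in>{1..<2 * Suc m + 1}. if even b then real b ^ 4 else 0) =
        real (2 * m + 2) ^ 4 + (\<Sum>b\<in>{1..<2 * m + 1}. if even b then real b ^ 4 else 0)"
      by simp
    then show ?case
      unfolding Suc.IH by (simp add: field_simps eval_nat_numeral)
  qed simp
  then show ?thesis
    using assms by (auto elim!: oddE)
qed

lemma sum_alternating_lessThan:
  assumes "0 < m"
  shows "(\<Sum>x\<in>{1..<m}. (-1) ^ x) = (if even m then - 1 else 0 :: real)"
  using assms by (induction m rule: nat_induct_non_zero) auto

section \<open>The double convolution\<close>

text \<open>Separates the terms involving the conventional value at \<open>0\<close>, where the
  divisor sum formulas do not apply.\<close>

lemma sum_pairs_split_zero:
  fixes g :: "nat \<Rightarrow> nat \<Rightarrow> real"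
  assumes "0 < n"
  shows "(\<Sum>(i, j)\<in>{(i, j). i + j = n}. g i j) =
    g 0 n + g n 0 + (\<Sum>(i, j)\<in>{(i, j). 0 < i \<and> 0 < j \<and> i + j = n}. g i j)"
proof -
  have fin: "finite {(i, j). 0 < i \<and> 0 < j \<and> i + j = n}"
    by (rule finite_subset[of _ "{..n} \<times> {..n}"]) auto
  have "{(i, j). i + j = n} = insert (0, n) (insert (n, 0) {(i, j). 0 < i \<and> 0 < j \<and> i + j = n})"
    by auto
  then show ?thesis
    using fin assms by simp
qed

text \<open>Liouville's identity with \<open>f t = t^2\<close> applies because
  \<open>4 a b = (a + b)^2 - (a - b)^2\<close>. Even \<open>n\<close> is included since the triple
  convolution uses this at all positive \<open>m < n\<close>.\<close>

lemma sum_hat_sigma_pairs: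
  assumes "0 < n"
  shows "12 * (\<Sum>(i, j)\<in>{(i, j). i + j = n}. hat_sigma i * hat_sigma j) =
    (\<Sum>d | d dvd n. (3 + 2 * (-1) ^ (n div d)) * real d ^ 3)"
proof -
  have "4 * (\<Sum>(i, j)\<in>{(i, j). 0 < i \<and> 0 < j \<and> i + j = n}. hat_sigma i * hat_sigma j) =
      4 * (\<Sum>(i, j)\<in>{(i, j). 0 < i \<and> 0 < j \<and> i + j = n}.
        (\<Sum>d | d dvd i. - ((-1) ^ (i div d) * real d)) * (\<Sum>d | d dvd j. - ((-1) ^ (j div d) * real d)))"
    by (intro arg_cong[where f = "\<lambda>z. 4 * z"] sum.cong) (auto simp: hat_sigma_signed)
  also have "\<dots> = 4 * (\<Sum>(a, x, b, y)\<in>quad n. - ((-1) ^ x * real a) * - ((-1) ^ y * real b))"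
    by (subst sum_quad_conv[where u = "\<lambda>a x. - ((-1) ^ x * real a)"
          and v = "\<lambda>a x. - ((-1) ^ x * real a)"]) simp
  also have "\<dots> = (\<Sum>(a, x, b, y)\<in>quad n.
      (-1) ^ (x + y) * (real_of_int (int a + int b) ^ 2 - real_of_int (int a - int b) ^ 2))"
    unfolding sum_distrib_left
    by (rule sum.cong) (auto simp: power_add algebra_simps power2_eq_square)
  also have "\<dots> = (\<Sum>d | d dvd n. (-1) ^ 0 * (real d - 1) * real_of_int (int d) ^ 2 +
      2 * (-1) ^ (n div d) * (\<Sum>b\<in>{1..<d}. real_of_int (int b) ^ 2) -
      2 * real_of_int (int d) ^ 2 * (\<Sum>x\<in>{1..<n div d}. (-1) ^ x))"
    by (rule liouville) (use assms in \<open>auto simp: power_add\<close>)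
  finally have *: "4 * (\<Sum>(i, j)\<in>{(i, j). 0 < i \<and> 0 < j \<and> i + j = n}. hat_sigma i * hat_sigma j) = \<dots>" .
  \<comment> \<open>The two boundary terms give \<open>2 * 12 / 24 = 1\<close> times
    \<open>hat_sigma n\<close>.\<close>
  have "12 * (\<Sum>(i, j)\<in>{(i, j). i + j = n}. hat_sigma i * hat_sigma j) =
      hat_sigma n +
      3 * (4 * (\<Sum>(i, j)\<in>{(i, j). 0 < i \<and> 0 < j \<and> i + j = n}. hat_sigma i * hat_sigma j))"
    unfolding sum_pairs_split_zero[OF assms] by (simp add: hat_sigma_def[of 0])
  also have "\<dots> = (\<Sum>d | d dvd n. (3 + 2 * (-1) ^ (n div d)) * real d ^ 3)"
    unfolding * hat_sigma_signed[OF assms]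
    unfolding sum_distrib_left[where r = 3] sum.distrib[symmetric]
  \<comment> \<open>The boundary term cancels the linear term of the sum of squares. The quadratic
    terms cancel too, leaving \<open>5 * d^3\<close> or \<open>d^3\<close> as the cofactor is even
    or odd.\<close>
  proof (rule sum.cong)
    fix d assume "d \<in> {d. d dvd n}"
    then have pos: "0 < n div d"
      using assms by (auto elim: dvdE)
    show "- ((-1) ^ (n div d) * real d) + 3 * ((-1) ^ 0 * (real d - 1) * real_of_int (int d) ^ 2 +
        2 * (-1) ^ (n div d) * (\<Sum>b\<in>{1..<d}. real_of_int (int b) ^ 2) -
        2 * real_of_int (int d) ^ 2 * (\<Sum>x\<in>{1..<n div d}. (-1) ^ x)) =
        (3 + 2 * (-1) ^ (n div d)) * real d ^ 3"
      unfolding of_int_of_nat_eq sum_square_lessThan sum_alternating_lessThan[OF pos]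
      by (cases "even (n div d)") (auto simp: field_simps power2_eq_square power3_eq_cube)
  qed simp
  finally show ?thesis .
qed

section \<open>The triple convolution and sums with weight \<open>a^3 b\<close>\<close>

lemma sum_hat_sigma_triples:
  "(\<Sum>(i, j, k)\<in>{(i, j, k). i + j + k = n}. hat_sigma i * hat_sigma j * hat_sigma k) =
    (\<Sum>(m, k)\<in>{(m, k). m + k = n}.
      (\<Sum>(i, j)\<in>{(i, j). i + j = m}. hat_sigma i * hat_sigma j) * hat_sigma k)"
proof -
  have fin: "finite {(i, j). i + j = m}" for m :: nat
    by (rule finite_subset[of _ "{..m} \<times> {..m}"]) auto
  have "(\<Sum>(m, k)\<in>{(m, k). m + k = n}.
      (\<Sum>(i, j)\<in>{(i, j). i + j = m}. hat_sigma i * hat_sigma j) * hat_sigma k) =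
      (\<Sum>p\<in>{(m, k). m + k = n}. \<Sum>q\<in>{(i, j). i + j = fst p}.
        hat_sigma (fst q) * hat_sigma (snd q) * hat_sigma (snd p))"
    by (simp add: case_prod_beta sum_distrib_right)
  also have "\<dots> = (\<Sum>(p, q)\<in>(SIGMA p:{(m, k). m + k = n}. {(i, j). i + j = fst p}).
      hat_sigma (fst q) * hat_sigma (snd q) * hat_sigma (snd p))"
    using fin by (subst sum.Sigma) auto
  also have "\<dots> = (\<Sum>(i, j, k)\<in>{(i, j, k). i + j + k = n}. hat_sigma i * hat_sigma j * hat_sigma k)"
    by (rule sum.reindex_bij_witness[where i = "\<lambda>(i, j, k). ((i + j, k), i, j)"
          and j = "\<lambda>((m, k), i, j). (i, j, k)"]) auto
  finally show ?thesis by simp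
qed

text \<open>The weight on the left is \<open>(a + b)^4 - (a - b)^4\<close>, as Liouville's identity
  requires; swapping the two pairs identifies its halves.\<close>

lemma sum_quad_symmetrize:
  fixes w :: "nat \<Rightarrow> nat \<Rightarrow> nat \<Rightarrow> nat \<Rightarrow> real"
  assumes "\<And>a x b y. w a x b y = w b y a x"
  shows "(\<Sum>(a, x, b, y)\<in>quad n. w a x b y * (8 * (real a ^ 3 * real b + real a * real b ^ 3))) =
    16 * (\<Sum>(a, x, b, y)\<in>quad n. w a x b y * (real a ^ 3 * real b))"
proof -
  have swap: "(\<Sum>(a, x, b, y)\<in>quad n. w a x b y * (real a * real b ^ 3)) =
      (\<Sum>(a, x, b, y)\<in>quad n. w a x b y * (real a ^ 3 * real b))"
    using sum_quad_swap[where n = n and P = "\<lambda>_ _ _ _. True" and g = "\<lambda>a x b y. w a x b y * (real a * real b ^ 3)"] assms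
    by (simp add: mult.commute)
  have "(\<Sum>(a, x, b, y)\<in>quad n. w a x b y * (8 * (real a ^ 3 * real b + real a * real b ^ 3))) =
      8 * (\<Sum>(a, x, b, y)\<in>quad n. w a x b y * (real a ^ 3 * real b)) +
      8 * (\<Sum>(a, x, b, y)\<in>quad n. w a x b y * (real a * real b ^ 3))"
    unfolding sum_distrib_left sum.distrib[symmetric] by (rule sum.cong) (auto simp: algebra_simps)
  then show ?thesis
    unfolding swap by simp
qed

lemma sum_quad_signed_cube:
  assumes "odd n"
  shows "16 * (\<Sum>(a, x, b, y)\<in>quad n. (-1) ^ (x + y) * (real a ^ 3 * real b)) =
    (\<Sum>d | d dvd n. (9 * real d ^ 5 - 10 * real d ^ 3 + real d) / 15)"
proof -
  have "0 < n"
    using assms by (rule odd_pos)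
  have "16 * (\<Sum>(a, x, b, y)\<in>quad n. (-1) ^ (x + y) * (real a ^ 3 * real b)) =
      (\<Sum>(a, x, b, y)\<in>quad n.
        (-1) ^ (x + y) * (8 * (real a ^ 3 * real b + real a * real b ^ 3)))"
    by (rule sum_quad_symmetrize[symmetric]) (simp add: add.commute)
  also have "\<dots> = (\<Sum>(a, x, b, y)\<in>quad n.
      (-1) ^ (x + y) * (real_of_int (int a + int b) ^ 4 - real_of_int (int a - int b) ^ 4))"
    by (rule sum.cong) (auto simp: algebra_simps eval_nat_numeral)
  also have "\<dots> = (\<Sum>d | d dvd n. (-1) ^ 0 * (real d - 1) * real_of_int (int d) ^ 4 +
      2 * (-1) ^ (n div d) * (\<Sum>b\<in>{1..<d}. real_of_int (int b) ^ 4) -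
      2 * real_of_int (int d) ^ 4 * (\<Sum>x\<in>{1..<n div d}. (-1) ^ x))"
    by (rule liouville) (use \<open>0 < n\<close> in \<open>auto simp: power_add\<close>)
  also have "\<dots> = (\<Sum>d | d dvd n. (9 * real d ^ 5 - 10 * real d ^ 3 + real d) / 15)"
  \<comment> \<open>All cofactors are odd, so the middle sign is \<open>-1\<close> and the
    alternating sum vanishes.\<close>
  proof (rule sum.cong)
    fix d assume "d \<in> {d. d dvd n}"
    then have "odd (n div d)"
      using assms by (metis dvd_mult dvd_mult_div_cancel mem_Collect_eq)
    moreover from this have pos: "0 < n div d"
      by (rule odd_pos)
    ultimately show "(-1) ^ 0 * (real d - 1) * real_of_int (int d) ^ 4 +
        2 * (-1) ^ (n div d) * (\<Sum>b\<in>{1..<d}. real_of_int (int b) ^ 4) -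
        2 * real_of_int (int d) ^ 4 * (\<Sum>x\<in>{1..<n div d}. (-1) ^ x) =
        (9 * real d ^ 5 - 10 * real d ^ 3 + real d) / 15"
      unfolding of_int_of_nat_eq sum_power4_lessThan sum_alternating_lessThan[OF pos]
      by (simp add: field_simps eval_nat_numeral)
  qed simp
  finally show ?thesis .
qed

text \<open>For odd \<open>n\<close>, \<open>a + b\<close> is even only if \<open>a\<close> and \<open>b\<close> are both odd, so cutting \<open>t^4\<close> off at
  odd \<open>t\<close> isolates these terms.\<close>
lemma sum_quad_odd_cube:
  assumes "odd n"
  shows "16 * (\<Sum>(a, x, b, y)\<in>quad n. (if odd a \<and> odd b then 1 else 0) * (real a ^ 3 * real b)) =
    (\<Sum>d | d dvd n. (3 * real d ^ 5 - 10 * real d ^ 3 + 7 * real d) / 15)"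
proof -
  define f :: "int \<Rightarrow> real" where "f t = (if even t then real_of_int t ^ 4 else 0)" for t
  have "0 < n"
    using assms by (rule odd_pos)
  have "16 * (\<Sum>(a, x, b, y)\<in>quad n. (if odd a \<and> odd b then 1 else 0) * (real a ^ 3 * real b)) =
      (\<Sum>(a, x, b, y)\<in>quad n. (if odd a \<and> odd b then 1 else 0) *
        (8 * (real a ^ 3 * real b + real a * real b ^ 3)))"
    by (rule sum_quad_symmetrize[symmetric]) auto
  also have "\<dots> = (\<Sum>(a, x, b, y)\<in>quad n. 1 * (f (int a + int b) - f (int a - int b)))"
  proof (rule sum.cong, goal_cases)
    case (2 q)
    then obtain a x b y where q: "q = (a, x, b, y)" "a * x + b * y = n"
      by (auto simp: quad_def)
    have "odd a \<and> odd b \<longleftrightarrow> even (int a + int b)"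
      using q(2) assms by auto
    then show ?case
      using q(1) by (auto simp: f_def algebra_simps eval_nat_numeral)
  qed simp
  also have "\<dots> = (\<Sum>d | d dvd n. 1 * (real d - 1) * f (int d) +
      2 * 1 * (\<Sum>b\<in>{1..<d}. f (int b)) - 2 * f (int d) * (\<Sum>x\<in>{1..<n div d}. 1))"
    by (rule liouville) (use \<open>0 < n\<close> in \<open>auto simp: f_def\<close>)
  also have "\<dots> = (\<Sum>d | d dvd n. (3 * real d ^ 5 - 10 * real d ^ 3 + 7 * real d) / 15)"
  proof (rule sum.cong)
    fix d assume "d \<in> {d. d dvd n}"
    \<comment> \<open>At odd \<open>d\<close> the function \<open>f\<close> vanishes, so only the
      sum over \<open>b\<close> survives.\<close>
    then have "odd d"
      using assms by (auto elim: dvdE)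
    moreover have "(\<Sum>b\<in>{1..<d}. f (int b)) = (\<Sum>b\<in>{1..<d}. if even b then real b ^ 4 else 0)"
      by (rule sum.cong) (auto simp: f_def)
    ultimately show "1 * (real d - 1) * f (int d) + 2 * 1 * (\<Sum>b\<in>{1..<d}. f (int b)) -
        2 * f (int d) * (\<Sum>x\<in>{1..<n div d}. 1) =
        (3 * real d ^ 5 - 10 * real d ^ 3 + 7 * real d) / 15"
      using sum_even_power4_lessThan[OF \<open>odd d\<close>] by (simp add: f_def)
  qed simp
  finally show ?thesis .
qed

text \<open>Trades the coefficients of the double convolution for divisor sums whose weight, signed or
  odd, matches one of the two expressions of the remaining factor \<open>hat_sigma\<close>.\<close>
lemma sum_divisors_cube_decomp:
  assumes "0 < m"
  shows "(\<Sum>d | d dvd m. (3 + 2 * (-1) ^ (m div d)) * real d ^ 3) =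
    - 2 * (\<Sum>d | d dvd m. (-1) ^ (m div d) * real d ^ 3) -
    (\<Sum>d | d dvd m. if odd d then real d ^ 3 else 0)"
  \<comment> \<open>Coefficientwise \<open>5 = -2 + 7\<close> at even cofactors, with
    \<open>7 = 2^3 - 1\<close>, and \<open>1 = 2 - 1\<close> at odd ones.\<close>
  unfolding sum_odd_divisors_power[OF assms] sum_distrib_left sum_subtractf[symmetric]
  by (rule sum.cong) auto

text \<open>The signed cube sum is multiplied by the signed form of \<open>hat_sigma k\<close>, the
  odd cube sum by its odd-divisor form, so each product has a weight that Liouville's identity can
  handle.\<close>

lemma sum_cube_hat_sigma:
  "(\<Sum>(m, k)\<in>{(m, k). 0 < m \<and> 0 < k \<and> m + k = n}.
      (\<Sum>d | d dvd m. (3 + 2 * (-1) ^ (m div d)) * real d ^ 3) * hat_sigma k) =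
    2 * (\<Sum>(a, x, b, y)\<in>quad n. (-1) ^ (x + y) * (real a ^ 3 * real b)) -
    (\<Sum>(a, x, b, y)\<in>quad n. (if odd a \<and> odd b then 1 else 0) * (real a ^ 3 * real b))"
proof -
  let ?P = "{(m, k). 0 < m \<and> 0 < k \<and> m + k = n}"
  have "(\<Sum>(m, k)\<in>?P. (\<Sum>d | d dvd m. (3 + 2 * (-1) ^ (m div d)) * real d ^ 3) * hat_sigma k) =
      (\<Sum>(m, k)\<in>?P. 2 * ((\<Sum>d | d dvd m. (-1) ^ (m div d) * real d ^ 3) *
          (\<Sum>d | d dvd k. (-1) ^ (k div d) * real d)) -
        (\<Sum>d | d dvd m. if odd d then real d ^ 3 else 0) * (\<Sum>d | d dvd k. if odd d then real d else 0))"
  proof (rule sum.cong, goal_cases)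
    case (2 p)
    then obtain m k where p: "p = (m, k)" "0 < m" "0 < k"
      by auto
    have "hat_sigma k = - (\<Sum>d | d dvd k. (-1) ^ (k div d) * real d)"
      using p by (simp add: hat_sigma_signed sum_negf)
    moreover have "hat_sigma k = (\<Sum>d | d dvd k. if odd d then real d else 0)"
      using p by (simp add: hat_sigma_odd_divisors)
    moreover have "(- 2 * U - W) * h = 2 * (U * V) - W * Q" if "h = - V" "h = Q" for U V W Q h :: real
      unfolding that(2)[symmetric] that(1) by (simp add: algebra_simps)
    ultimately show ?case
      unfolding p(1) prod.case sum_divisors_cube_decomp[OF p(2)] by blast
  qed simp
  also have "\<dots> =
      2 * (\<Sum>(a, x, b, y)\<in>quad n. ((-1) ^ x * real a ^ 3) * ((-1) ^ y * real b)) -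
      (\<Sum>(a, x, b, y)\<in>quad n. (if odd a then real a ^ 3 else 0) * (if odd b then real b else 0))"
    unfolding sum_quad_conv[where u = "\<lambda>a x. (-1) ^ x * real a ^ 3" and v = "\<lambda>b y. (-1) ^ y * real b"]
      sum_quad_conv[where u = "\<lambda>a x. if odd a then real a ^ 3 else 0" and v = "\<lambda>b y. if odd b then real b else 0"]
      sum_distrib_left[where r = 2] sum_subtractf[symmetric]
    by (rule sum.cong) auto
  also have "\<dots> = 2 * (\<Sum>(a, x, b, y)\<in>quad n. (-1) ^ (x + y) * (real a ^ 3 * real b)) -
      (\<Sum>(a, x, b, y)\<in>quad n. (if odd a \<and> odd b then 1 else 0) * (real a ^ 3 * real b))"
    by (intro arg_cong2[where f = "(-)"] arg_cong[where f = "\<lambda>z. 2 * z"] sum.cong)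
      (auto simp: power_add)
  finally show ?thesis .
qed

theorem corollary3p4:
  fixes n :: nat
  assumes "odd n"
  shows "real (divisor_sigma 3 n) =
           12 * (\<Sum>(i, j)\<in>{(i, j). i + j = n}. hat_sigma i * hat_sigma j) \<and>
         real (divisor_sigma 5 n) =
           192 * (\<Sum>(i, j, k)\<in>{(i, j, k). i + j + k = n}. hat_sigma i * hat_sigma j * hat_sigma k)"
proof -
  let ?C = "\<lambda>m. \<Sum>(i, j)\<in>{(i, j). i + j = m}. hat_sigma i * hat_sigma j"
  have n: "0 < n"
    using assms by (rule odd_pos)
  have odd_div: "odd (n div d)" if "d dvd n" for d
    using assms that by (metis dvd_mult dvd_mult_div_cancel)
  have C_n: "12 * ?C n = (\<Sum>d | d dvd n. real d ^ 3)"
    unfolding sum_hat_sigma_pairs[OF n] by (rule sum.cong) (use odd_div in auto)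
  have C_0: "?C 0 = 1 / 576"
  proof -
    have "{(i, j). i + j = (0 :: nat)} = {(0, 0)}"
      by auto
    then show ?thesis
      by (simp add: hat_sigma_def)
  qed
  have hat_n: "hat_sigma n = (\<Sum>d | d dvd n. real d)"
    unfolding hat_sigma_signed[OF n] by (rule sum.cong) (use odd_div in auto)
  have "12 * (\<Sum>(m, k)\<in>{(m, k). 0 < m \<and> 0 < k \<and> m + k = n}. ?C m * hat_sigma k) =
      (\<Sum>(m, k)\<in>{(m, k). 0 < m \<and> 0 < k \<and> m + k = n}.
        (\<Sum>d | d dvd m. (3 + 2 * (-1) ^ (m div d)) * real d ^ 3) * hat_sigma k)"
    unfolding sum_distrib_left
    by (rule sum.cong) (auto simp: sum_hat_sigma_pairs[symmetric])
  \<comment> \<open>The factor is \<open>192 = 16 * 12\<close>, with \<open>16\<close> from the two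
    sums of weight \<open>a^3 b\<close>.\<close>
  then have pos: "192 * (\<Sum>(m, k)\<in>{(m, k). 0 < m \<and> 0 < k \<and> m + k = n}. ?C m * hat_sigma k) =
      2 * (\<Sum>d | d dvd n. (9 * real d ^ 5 - 10 * real d ^ 3 + real d) / 15) -
      (\<Sum>d | d dvd n. (3 * real d ^ 5 - 10 * real d ^ 3 + 7 * real d) / 15)"
    unfolding sum_cube_hat_sigma sum_quad_signed_cube[OF assms, symmetric]
      sum_quad_odd_cube[OF assms, symmetric] by linarith
  \<comment> \<open>The term \<open>m = 0\<close> has coefficient \<open>192 / 576 = 1 / 3\<close>,
    and \<open>k = 0\<close> has \<open>192 / 24 = 8 = 2 / 3 * 12\<close>.\<close>
  have "192 * (\<Sum>(i, j, k)\<in>{(i, j, k). i + j + k = n}. hat_sigma i * hat_sigma j * hat_sigma k) =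
      hat_sigma n / 3 + 2 / 3 * (12 * ?C n) +
      192 * (\<Sum>(m, k)\<in>{(m, k). 0 < m \<and> 0 < k \<and> m + k = n}. ?C m * hat_sigma k)"
    unfolding sum_hat_sigma_triples sum_pairs_split_zero[OF n, of "\<lambda>m k. ?C m * hat_sigma k"] C_0
    by (simp add: hat_sigma_def[of 0])
  \<comment> \<open>The coefficient of \<open>d^5\<close> is \<open>(18 - 3) / 15 = 1\<close>. Those
    of \<open>d^3\<close> and \<open>d\<close> are \<open>2/3 - 10/15\<close> and
    \<open>1/3 - 5/15\<close>, both zero.\<close>
  also have "\<dots> = (\<Sum>d | d dvd n. real d ^ 5)"
    unfolding pos C_n hat_n
    unfolding sum_distrib_left sum_divide_distrib sum.distrib[symmetric]
      sum_subtractf[symmetric]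
    by (rule sum.cong) (auto simp: field_simps)
  finally show ?thesis
    using C_n by (simp add: divisor_sigma_def)
qed

end
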